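(* Assume that the interference graph $G=(\mathcal{C},\mathcal{E})$ is complete and that $$\max_{c\in\mathcal{C}}\frac{\lambda_c}{\nu_c}<1-\sum_{d\in\mathcal{C}}\frac{\lambda_d}{\mu_d}.$$ Then the unique fixed point in $E^1$ of the initial-value problem $\frac{dx(t)}{dt}=H(x(t))$, $x(0)=x^\infty$ (i.e. the unique $x^*\in E^1$ with $H(x^* )=0$) is given by $$x^*_{c,n}=(1-\xi_c)\xi_c^n,\qquad \xi_c=\frac{\lambda_c}{\nu_c\big(1-\sum_{d\in\mathcal{C}}\frac{\lambda_d}{\mu_d}\big)},\qquad c\in\mathcal{C},\ n\in\mathbb{N}_0.$$
   Context: $\mathcal{C}=\{1,\dots,C\}$; $\lambda_c,\mu_c,\nu_c,p_c$ ($c\in\mathcal{C}$) are positive constants with $\sum_cp_c=1$. $\Omega\subset\{0,1\}^C$ is the set of $\omega$ with $\omega_c\omega_d=0$ whenever $(c,d)\in\mathcal{E}$, so for complete $G$, $\Omega=\{0,e_1,\dots,e_C\}$ with $e_c$ the unit vectors; $\Omega_{-c}=\{\omega\in\Omega:\omega_c=0,\ \omega_d=0\ \forall d\text{ with }(c,d)\in\mathcal{E}\}$, so for complete $G$, $\Omega_{-c}=\{0\}$ for every $c$. $E^1=\{x=(x_{c,n})_{c\in\mathcal{C},n\in\mathbb{N}_0}:x_{c,n}\ge0,\ \sum_{n\ge0}x_{c,n}=1\ \forall c\}$. With $e_{c,n}$ the unit vector in position $(c,n)$, $$H(x)=\sum_{c\in\mathcal{C}}\frac{1}{p_c}\Big(\lambda_c\sum_{n=0}^{\infty}x_{c,n}(e_{c,n+1}-e_{c,n})+\pi_{x_0}(\Omega_{-c})\nu_c\sum_{n=1}^{\infty}x_{c,n}(e_{c,n-1}-e_{c,n})\Big),$$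 where $x_0=(x_{1,0},\dots,x_{C,0})$, $\pi_{x_0}(\Omega_{-c})=\sum_{\omega\in\Omega_{-c}}\pi(\omega;e-x_0)$, $e=(1,\dots,1)$, and $\pi(\omega;\eta)=\prod_c(\eta_c\nu_c/\mu_c)^{\omega_c}\big/\sum_{\omega'\in\Omega}\prod_c(\eta_c\nu_c/\mu_c)^{\omega'_c}$ (convention $0^0=1$). For complete $G$ this gives $\pi_{x_0}(\Omega_{-c})=\big(1+\sum_{d}\frac{\nu_d}{\mu_d}(1-x_{d,0})\big)^{-1}$. *)

theory Defs
  imports Complex_Main
begin

text \<open>
  The classes are the elements of a finite type \<open>'c\<close>, so that \<open>C = CARD('c)\<close>. The interference
  graph is given by its symmetric, irreflexive edge relation \<open>E\<close> on \<open>'c\<close>. A state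
  \<open>x = (x_{c,n})\<close> is a function \<open>x c n\<close>.
\<close>

definition complete_graph :: "('c \<times> 'c) set \<Rightarrow> bool" where
  "complete_graph E \<longleftrightarrow> E = {(c, d). c \<noteq> d}"

definition activity_states :: "('c \<times> 'c) set \<Rightarrow> ('c \<Rightarrow> nat) set" where
  "activity_states E =
     {\<omega>. (\<forall>c. \<omega> c \<in> {0, 1}) \<and> (\<forall>c d. (c, d) \<in> E \<longrightarrow> \<omega> c * \<omega> d = 0)}"

definition activity_states_free :: "('c \<times> 'c) set \<Rightarrow> 'c \<Rightarrow> ('c \<Rightarrow> nat) set" where
  "activity_states_free E c =
     {\<omega> \<in> activity_states E. \<omega> c = 0 \<and> (\<forall>d. (c, d) \<in> E \<longrightarrow> \<omega> d = 0)}"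

definition activity_weight ::
  "('c::finite \<Rightarrow> real) \<Rightarrow> ('c \<Rightarrow> real) \<Rightarrow> ('c \<Rightarrow> real) \<Rightarrow> ('c \<Rightarrow> nat) \<Rightarrow> real" where
  "activity_weight \<mu> \<nu> \<eta> \<omega> = (\<Prod>c\<in>UNIV. (\<eta> c * \<nu> c / \<mu> c) ^ \<omega> c)"

definition activity_prob ::
  "('c::finite \<times> 'c) set \<Rightarrow> ('c \<Rightarrow> real) \<Rightarrow> ('c \<Rightarrow> real) \<Rightarrow> ('c \<Rightarrow> real) \<Rightarrow> ('c \<Rightarrow> nat) \<Rightarrow> real" where
  "activity_prob E \<mu> \<nu> \<eta> \<omega> =
     activity_weight \<mu> \<nu> \<eta> \<omega> / (\<Sum>\<omega>'\<in>activity_states E. activity_weight \<mu> \<nu> \<eta> \<omega>')"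

text \<open>The probability \<open>\<pi>_{x_0}(\<Omega>_{-c})\<close>.\<close>

definition free_prob ::
  "('c::finite \<times> 'c) set \<Rightarrow> ('c \<Rightarrow> real) \<Rightarrow> ('c \<Rightarrow> real) \<Rightarrow> ('c \<Rightarrow> nat \<Rightarrow> real) \<Rightarrow> 'c \<Rightarrow> real" where
  "free_prob E \<mu> \<nu> x c =
     (\<Sum>\<omega>\<in>activity_states_free E c. activity_prob E \<mu> \<nu> (\<lambda>d. 1 - x d 0) \<omega>)"

definition E1 :: "('c \<Rightarrow> nat \<Rightarrow> real) set" where
  "E1 = {x. \<forall>c. (\<forall>n. x c n \<ge> 0) \<and> (\<lambda>n. x c n) sums 1}"

definition unit_vec :: "'c \<Rightarrow> nat \<Rightarrow> 'c \<Rightarrow> nat \<Rightarrow> real" where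
  "unit_vec c n d m = (if d = c \<and> m = n then 1 else 0)"

text \<open>
  The infinite sums of vectors are taken componentwise; in every component \<open>(d, m)\<close> at most two
  summands are nonzero, so they converge. The sum over \<open>n \<ge> 1\<close> is re-indexed to start at \<open>0\<close>.
\<close>

definition H ::
  "('c::finite \<times> 'c) set \<Rightarrow> ('c \<Rightarrow> real) \<Rightarrow> ('c \<Rightarrow> real) \<Rightarrow> ('c \<Rightarrow> real) \<Rightarrow> ('c \<Rightarrow> real)
    \<Rightarrow> ('c \<Rightarrow> nat \<Rightarrow> real) \<Rightarrow> 'c \<Rightarrow> nat \<Rightarrow> real" where
  "H E lam \<mu> \<nu> p x d m =
     (\<Sum>c\<in>UNIV. 1 / p c *
        (lam c * (\<Sum>n. x c n * (unit_vec c (Suc n) d m - unit_vec c n d m))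
         + free_prob E \<mu> \<nu> x c * \<nu> c *
             (\<Sum>n. x c (Suc n) * (unit_vec c n d m - unit_vec c (Suc n) d m))))"

definition fixed_point ::
  "('c::finite \<times> 'c) set \<Rightarrow> ('c \<Rightarrow> real) \<Rightarrow> ('c \<Rightarrow> real) \<Rightarrow> ('c \<Rightarrow> real) \<Rightarrow> ('c \<Rightarrow> real)
    \<Rightarrow> ('c \<Rightarrow> nat \<Rightarrow> real) \<Rightarrow> bool" where
  "fixed_point E lam \<mu> \<nu> p x \<longleftrightarrow> (\<forall>d m. H E lam \<mu> \<nu> p x d m = 0)"

end

theory Submission
  imports Defs
begin

text \<open>
  In a fixed point the flow balance between consecutive queue lengths,
  \<open>\<lambda>_c x_{c,n} = \<pi> \<nu>_c x_{c,n+1}\<close> with \<open>\<pi> = \<pi>_{x_0}(\<Omega>_{-c})\<close>, follows by induction from \<open>n = 0\<close>.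
  Hence each \<open>x_c\<close> is geometric with ratio \<open>1 - x_{c,0} = \<lambda>_c / (\<pi> \<nu>_c)\<close>. Inserting this into
  \<open>1 / \<pi> = 1 + \<Sum>_d (\<nu>_d / \<mu>_d) (1 - x_{d,0})\<close> gives the self-consistency equation
  \<open>1 / \<pi> = 1 + (1 / \<pi>) \<Sum>_d \<lambda>_d / \<mu>_d\<close>, whose only solution is \<open>\<pi> = 1 - \<Sum>_d \<lambda>_d / \<mu>_d\<close>.
\<close>

text \<open>Any two distinct classes are adjacent, so at most one coordinate of an activity state
  can be 1.\<close>

lemma activity_states_complete:
  assumes "complete_graph E"
  shows "activity_states E = insert (\<lambda>_. 0) (range (\<lambda>c d. if d = c then 1 else 0))"
proof (intro equalityI subsetI)
  fix \<omega> assume \<omega>: "\<omega> \<in> activity_states E"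
  then have bin: "\<omega> c \<in> {0, 1}" for c
    by (simp add: activity_states_def)
  have excl: "c \<noteq> d \<Longrightarrow> \<omega> c = 0 \<or> \<omega> d = 0" for c d
    using \<omega> assms by (auto simp: activity_states_def complete_graph_def)
  show "\<omega> \<in> insert (\<lambda>_. 0) (range (\<lambda>c d. if d = c then 1 else 0))"
  proof (cases "\<exists>c. \<omega> c \<noteq> 0")
    case True
    then obtain c where "\<omega> c \<noteq> 0" by blast
    then have "\<omega> = (\<lambda>d. if d = c then 1 else 0)"
      using bin[of c] excl[of c] by auto
    then show ?thesis by blast
  qed auto
qed (use assms in \<open>auto simp: activity_states_def complete_graph_def\<close>)

lemma activity_states_free_complete:
  assumes "complete_graph E"
  shows "activity_states_free E c = {\<lambda>_. 0}"
proof (intro equalityI subsetI)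
  fix \<omega> assume "\<omega> \<in> activity_states_free E c"
  then have "\<omega> d = 0" for d
    using assms by (cases "d = c") (auto simp: activity_states_free_def complete_graph_def)
  then show "\<omega> \<in> {\<lambda>_. 0}" by auto
qed (auto simp: activity_states_free_def activity_states_def)

lemma activity_weight_zero [simp]: "activity_weight \<mu> \<nu> \<eta> (\<lambda>_. 0) = 1"
  by (simp add: activity_weight_def)

lemma activity_weight_unit:
  "activity_weight \<mu> \<nu> \<eta> (\<lambda>d. if d = c then 1 else 0) = \<eta> c * \<nu> c / \<mu> c"
proof -
  have "activity_weight \<mu> \<nu> \<eta> (\<lambda>d. if d = c then 1 else 0)
      = (\<Prod>d\<in>UNIV. if d = c then \<eta> d * \<nu> d / \<mu> d else 1)"
    unfolding activity_weight_def by (rule prod.cong) auto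
  then show ?thesis by simp
qed

lemma sum_activity_weight_complete:
  assumes "complete_graph E"
  shows "(\<Sum>\<omega>\<in>activity_states E. activity_weight \<mu> \<nu> \<eta> \<omega>) = 1 + (\<Sum>c\<in>UNIV. \<eta> c * \<nu> c / \<mu> c)"
proof -
  let ?e = "\<lambda>(c::'a) d. if d = c then 1 else (0::nat)"
  \<comment> \<open>Injectivity, together with the zero state not being a unit vector, ensures that
    the reindexed sum counts every state once.\<close>
  have "inj ?e"
    by (rule injI) (metis zero_neq_one)
  moreover have "(\<lambda>_. 0) \<notin> range ?e"
  proof
    assume "(\<lambda>_. 0) \<in> range ?e"
    then obtain c where "(\<lambda>_. 0) = ?e c" by blast
    from fun_cong[OF this, of c] show False by simp
  qed
  ultimately show ?thesis
    by (simp add: activity_states_complete[OF assms] sum.reindex activity_weight_unit)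
qed

text \<open>Only the zero state, of weight 1, leaves \<open>c\<close> free. The result is the
  reciprocal of the normalising constant, and so the same for every class.\<close>

lemma free_prob_complete:
  assumes "complete_graph E"
  shows "free_prob E \<mu> \<nu> x c = 1 / (1 + (\<Sum>d\<in>UNIV. (1 - x d 0) * \<nu> d / \<mu> d))"
  by (simp add: free_prob_def activity_states_free_complete[OF assms] activity_prob_def
      sum_activity_weight_complete[OF assms])

lemma suminf_arrival:
  "(\<Sum>n. x n * (unit_vec c (Suc n) d m - unit_vec c n d m))
     = (if d = c then (case m of 0 \<Rightarrow> 0 | Suc k \<Rightarrow> x k) - x m else 0)"
proof (cases "d = c")
  case True
  have "(\<lambda>n. if n = m then x n else 0) sums x m"
    by (rule sums_single)
  \<comment> \<open>For \<open>m = 0\<close> every term vanishes; otherwise the only nonzero term is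
    at \<open>n = m - 1\<close>.\<close>
  moreover have "(\<lambda>n. if Suc n = m then x n else 0) sums (case m of 0 \<Rightarrow> 0 | Suc k \<Rightarrow> x k)"
    using sums_single[of "m - 1" x] by (cases m) simp_all
  ultimately have "(\<lambda>n. (if Suc n = m then x n else 0) - (if n = m then x n else 0))
      sums ((case m of 0 \<Rightarrow> 0 | Suc k \<Rightarrow> x k) - x m)"
    by (intro sums_diff)
  also have "(\<lambda>n. (if Suc n = m then x n else 0) - (if n = m then x n else 0))
      = (\<lambda>n. x n * (unit_vec c (Suc n) d m - unit_vec c n d m))"
    using True by (auto simp: unit_vec_def)
  finally show ?thesis using True by (simp add: sums_iff)
qed (simp add: unit_vec_def)

text \<open>A departure is an arrival with the sign reversed, so \<open>suminf_arrival\<close>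
  applies to the sequence \<open>- x (Suc n)\<close>.\<close>

lemma suminf_departure:
  "(\<Sum>n. x (Suc n) * (unit_vec c n d m - unit_vec c (Suc n) d m))
     = (if d = c then x (Suc m) - (case m of 0 \<Rightarrow> 0 | Suc k \<Rightarrow> x (Suc k)) else 0)"
proof -
  have "(\<Sum>n. x (Suc n) * (unit_vec c n d m - unit_vec c (Suc n) d m))
      = (\<Sum>n. - x (Suc n) * (unit_vec c (Suc n) d m - unit_vec c n d m))"
    by (simp add: algebra_simps)
  also have "\<dots> = (if d = c then x (Suc m) - (case m of 0 \<Rightarrow> 0 | Suc k \<Rightarrow> x (Suc k)) else 0)"
    unfolding suminf_arrival[of "\<lambda>n. - x (Suc n)"] by (simp split: nat.split)
  finally show ?thesis .
qed

lemma H_component: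
  "H E lam \<mu> \<nu> p x c m = 1 / p c *
     (lam c * ((case m of 0 \<Rightarrow> 0 | Suc k \<Rightarrow> x c k) - x c m)
      + free_prob E \<mu> \<nu> x c * \<nu> c * (x c (Suc m) - (case m of 0 \<Rightarrow> 0 | Suc k \<Rightarrow> x c (Suc k))))"
  (is "_ = ?F c")
proof -
  have "H E lam \<mu> \<nu> p x c m = (\<Sum>b\<in>UNIV. if c = b then ?F b else 0)"
    unfolding H_def suminf_arrival suminf_departure by (rule sum.cong) auto
  then show ?thesis by simp
qed

text \<open>Up to the factor \<open>1 / p c\<close>, component \<open>Suc n\<close> of
  \<open>H\<close> is the difference of the balance equations at \<open>n\<close> and
  \<open>Suc n\<close>. Component 0 has no lower neighbour and is the balance at 0 itself, which
  starts the induction.\<close>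

lemma fixed_point_iff_balance:
  assumes "\<And>c. p c \<noteq> 0"
  shows "fixed_point E lam \<mu> \<nu> p x
    \<longleftrightarrow> (\<forall>c n. lam c * x c n = free_prob E \<mu> \<nu> x c * \<nu> c * x c (Suc n))"
proof
  assume fp: "fixed_point E lam \<mu> \<nu> p x"
  show "\<forall>c n. lam c * x c n = free_prob E \<mu> \<nu> x c * \<nu> c * x c (Suc n)"
  proof (intro allI)
    fix c n
    have H0: "H E lam \<mu> \<nu> p x c m = 0" for m
      using fp by (simp add: fixed_point_def)
    show "lam c * x c n = free_prob E \<mu> \<nu> x c * \<nu> c * x c (Suc n)"
    proof (induction n)
      case 0
      show ?case using H0[of 0] assms[of c] by (simp add: H_component)
    next
      case (Suc n)
      then show ?case using H0[of "Suc n"] assms[of c] by (simp add: H_component algebra_simps)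
    qed
  qed
next
  assume "\<forall>c n. lam c * x c n = free_prob E \<mu> \<nu> x c * \<nu> c * x c (Suc n)"
  then show "fixed_point E lam \<mu> \<nu> p x"
    by (simp add: fixed_point_def H_component algebra_simps split: nat.split)
qed

text \<open>The tail sum from index 1 on has two values: \<open>1 - y 0\<close> by dropping the
  first term, and \<open>r\<close> by the recursion.\<close>

lemma geometric_sums_1_imp:
  fixes y :: "nat \<Rightarrow> real"
  assumes step: "\<And>n. y (Suc n) = r * y n" and y: "y sums 1"
  shows "r = 1 - y 0" and "y = (\<lambda>n. y 0 * r ^ n)"
proof -
  have "(\<lambda>n. y (Suc n)) sums (1 - y 0)"
    using y by (simp add: sums_Suc_iff)
  moreover have "(\<lambda>n. y (Suc n)) sums (r * 1)"
    unfolding step by (intro sums_mult y)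
  ultimately show "r = 1 - y 0"
    using sums_unique2 by fastforce
  have "y n = y 0 * r ^ n" for n
    by (induction n) (simp_all add: step)
  then show "y = (\<lambda>n. y 0 * r ^ n)" by blast
qed

theorem corollary5p1:
  fixes E :: "('c::finite \<times> 'c) set"
    and lam \<mu> \<nu> p \<xi> :: "'c \<Rightarrow> real"
  assumes lam_pos: "\<And>c. lam c > 0"
    and mu_pos: "\<And>c. \<mu> c > 0"
    and nu_pos: "\<And>c. \<nu> c > 0"
    and p_pos: "\<And>c. p c > 0"
    and p_sum: "(\<Sum>c\<in>UNIV. p c) = 1"
    and complete: "complete_graph E"
    and stable: "(MAX c. lam c / \<nu> c) < 1 - (\<Sum>d\<in>UNIV. lam d / \<mu> d)"
    and xi_eq: "\<And>c. \<xi> c = lam c / (\<nu> c * (1 - (\<Sum>d\<in>UNIV. lam d / \<mu> d)))"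
  shows "\<forall>x. x \<in> E1 \<and> fixed_point E lam \<mu> \<nu> p x \<longleftrightarrow> x = (\<lambda>c n. (1 - \<xi> c) * \<xi> c ^ n)"
proof (intro allI iffI)
  define s where "s = 1 - (\<Sum>d\<in>UNIV. lam d / \<mu> d)"
  have ratio_less: "lam c / \<nu> c < s" for c
    using stable by (simp add: s_def)
  \<comment> \<open>Some positive ratio \<open>lam c / \<nu> c\<close> lies below \<open>s\<close>;
    \<open>undefined\<close> serves as an arbitrary class.\<close>
  have s_pos: "s > 0"
    using ratio_less[of undefined] divide_pos_pos[OF lam_pos nu_pos, of undefined undefined]
    by linarith
  have xi: "\<xi> c = lam c / (\<nu> c * s)" for c
    by (simp add: xi_eq s_def)
  have p_nz: "p c \<noteq> 0" for c
    using p_pos[of c] by simp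
  {
    fix x :: "'c \<Rightarrow> nat \<Rightarrow> real"
    assume "x \<in> E1 \<and> fixed_point E lam \<mu> \<nu> p x"
    then have sums: "x c sums 1" and nonneg: "x c n \<ge> 0" and fp: "fixed_point E lam \<mu> \<nu> p x" for c n
      by (auto simp: E1_def)
    define P where "P = 1 / (1 + (\<Sum>d\<in>UNIV. (1 - x d 0) * \<nu> d / \<mu> d))"
    have P: "free_prob E \<mu> \<nu> x c = P" for c
      by (simp add: P_def free_prob_complete[OF complete])
    \<comment> \<open>A single term is at most the total mass 1. This makes the denominator of
      \<open>P\<close> at least 1, so that \<open>P\<close> is positive and can be inverted.\<close>
    have "x d 0 \<le> 1" for d
      using sum_le_suminf[of "x d" "{0}"] sums[of d] nonneg by (simp add: sums_iff)
    then have "(\<Sum>d\<in>UNIV. (1 - x d 0) * \<nu> d / \<mu> d) \<ge> 0"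
      using mu_pos nu_pos by (intro sum_nonneg) (simp add: less_imp_le)
    then have P_pos: "P > 0"
      and P_inv: "1 / P = 1 + (\<Sum>d\<in>UNIV. (1 - x d 0) * \<nu> d / \<mu> d)"
      by (simp_all add: P_def)
    have "lam c * x c n = P * \<nu> c * x c (Suc n)" for c n
      using fp by (simp add: fixed_point_iff_balance[OF p_nz] P)
    then have step: "x c (Suc n) = lam c / (P * \<nu> c) * x c n" for c n
      using P_pos nu_pos[of c] by (simp add: field_simps)
    note ratio = geometric_sums_1_imp(1)[OF step sums] and geom = geometric_sums_1_imp(2)[OF step sums]
    \<comment> \<open>Reading \<open>ratio\<close> backwards replaces \<open>1 - x d 0\<close> by
      \<open>lam d / (P * \<nu> d)\<close>, and \<open>\<nu> d\<close> cancels.\<close>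
    have "(1 - x d 0) * \<nu> d / \<mu> d = 1 / P * (lam d / \<mu> d)" for d
      using nu_pos[of d] by (simp flip: ratio)
    then have "(\<Sum>d\<in>UNIV. (1 - x d 0) * \<nu> d / \<mu> d) = 1 / P * (1 - s)"
      by (simp only: s_def flip: sum_distrib_left) simp
    with P_inv have "1 / P = 1 + 1 / P * (1 - s)"
      by (simp only:)
    then have "P = s"
      using P_pos by (simp add: field_simps)
    then have "lam c / (P * \<nu> c) = \<xi> c" for c
      by (simp add: xi mult.commute)
    then have "\<xi> c = 1 - x c 0" and "x c = (\<lambda>n. x c 0 * \<xi> c ^ n)" for c
      using ratio[of c] geom[of c] by simp_all
    moreover from this(1) have "x c 0 = 1 - \<xi> c" for c
      by simp
    ultimately have "x c n = (1 - \<xi> c) * \<xi> c ^ n" for c n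
      by metis
    then show "x = (\<lambda>c n. (1 - \<xi> c) * \<xi> c ^ n)"
      by (intro ext)
  next
    fix x :: "'c \<Rightarrow> nat \<Rightarrow> real"
    assume x: "x = (\<lambda>c n. (1 - \<xi> c) * \<xi> c ^ n)"
    \<comment> \<open>The bound \<open>\<xi> c < 1\<close> is the stability condition divided by
      \<open>s\<close>; it makes the geometric series converge.\<close>
    have xi_pos: "\<xi> c > 0" and xi_less: "\<xi> c < 1" for c
      using ratio_less[of c] lam_pos[of c] nu_pos[of c] s_pos by (simp_all add: xi field_simps)
    have "x c sums 1" for c
      using sums_mult[OF geometric_sums[of "\<xi> c"], of "1 - \<xi> c"] xi_pos[of c] xi_less[of c]
      by (simp add: x)
    then have "x \<in> E1"
      using xi_pos xi_less by (simp add: E1_def x less_imp_le)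
    have "(1 - x d 0) * \<nu> d / \<mu> d = 1 / s * (lam d / \<mu> d)" for d
      using nu_pos[of d] by (simp add: x xi)
    then have "(\<Sum>d\<in>UNIV. (1 - x d 0) * \<nu> d / \<mu> d) = 1 / s * (1 - s)"
      by (simp only: s_def flip: sum_distrib_left) simp
    \<comment> \<open>The denominator is \<open>1 + (1 - s) / s = 1 / s\<close>.\<close>
    then have "free_prob E \<mu> \<nu> x c = s" for c
      using s_pos unfolding free_prob_complete[OF complete] by (simp only:) (simp add: field_simps)
    \<comment> \<open>Multiplied by \<open>(1 - \<xi> c) * \<xi> c ^ n\<close>, this is the balance
      equation at \<open>n\<close>.\<close>
    moreover have "lam c = s * \<nu> c * \<xi> c" for c
      using s_pos nu_pos[of c] by (simp add: xi)
    ultimately have "fixed_point E lam \<mu> \<nu> p x"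
      by (simp add: fixed_point_iff_balance[OF p_nz] x)
    with \<open>x \<in> E1\<close> show "x \<in> E1 \<and> fixed_point E lam \<mu> \<nu> p x" by blast
  }
qed

end
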